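(* Let $C\subset\mathbb P^2$ be a plane curve of degree $d$ whose only singular point $p\in C$ is a linearly semi-quasihomogeneous singularity with respect to weights $\vec w=(w_1,w_2)$, $w_1\ge w_2>0$. Let $L_1,L_2$ be lines such that $C+L_1+L_2$ has simple normal crossings away from $p$. Let $f$ be the localization of the equation of $C$ at $p$ and $\vec w(f)$ its weighted degree with respect to $\vec w$. 1. Suppose $p\notin L_1\cup L_2$. Then $$\mathrm{Stab}(C,L_1,L_2)\subseteq\Big\{(t_1,t_2)\in\mathrm{Stab}(1,d,2)\ \Big|\ t_1+t_2-\frac{3\vec w(f)}{w_1+w_2}+d\ge0\Big\}.$$ 2. Suppose $p\notin L_2$ and $p\in L_1\cap C$. Then $$\mathrm{Stab}(C,L_1,L_2)\subseteq\Big\{(t_1,t_2)\in\mathrm{Stab}(1,d,2)\ \Big|\ t_2-t_1\frac{2w_2-w_1}{w_1+w_2}-\frac{3\vec w(f)}{w_1+w_2}+d\ge0\Big\}.$$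
   Context: Work over $\mathbb C$. A singularity $p$ of a plane curve $C$ is linearly semi-quasihomogeneous with respect to $\vec w=(w_1,w_2)$ if there are homogeneous coordinates $x_0,x_1,x_2$ on $\mathbb P^2$ with $p=[0:0:1]$ such that the local equation $f(x_0,x_1)$ of $C$ at $p$ (the equation of $C$ with $x_2=1$) is semi-quasihomogeneous in $x_0,x_1$, where $x_0$ has weight $w_1$ and $x_1$ has weight $w_2$: its part of lowest weighted degree defines an isolated singularity at the origin. The weighted degree is $\vec w(f)=\min\{w_1i_0+w_2i_1 : x_0^{i_0}x_1^{i_1}\text{ occurs in }f\}$ in these coordinates. Stability: let $C=\{F=0\}$, $L_i=\{l_i=0\}$ and $G=\mathrm{SL}_3$. A normalized one-parameter subgroup is $\lambda(s)=\mathrm{Diag}(s^{r_0},s^{r_1},s^{r_2})$ with $r_i\in\mathbb Z$, $\sum r_i=0$, $r_0\ge r_1\ge r_2$, not all zero. Put $\mu(g,\lambda)=\min\{\sum d_ir_i : x_0^{d_0}x_1^{d_1}x_2^{d_2}\text{ occurs in }g\}$. For $\vec t=(t_1,t_2)\in(\mathbb Q_{\ge0})^2$ put $\mu_{\vec t}((F,l_1,l_2),\lambda)=\mu(F,\lambda)+t_1\mu(l_1,\lambda)+t_2\mu(l_2,\lambda)$. The triple is $\vec t$-semistable if $\mu_{\vec t}(g\cdot(F,l_1,l_2),\lambda)\le0$ for all $g\in G$ and all normalized $\lambda$. $\mathrm{Stab}(1,d,2)$ is the set of $\vec t\in(\mathbb Q_{\ge0})^2$ for which some $\vec t$-semistable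 triple of a degree $d$ plane curve and two lines exists, and $\mathrm{Stab}(C,L_1,L_2)\subset\mathrm{Stab}(1,d,2)$ is the set of $(t_1,t_2)$ for which $(C,L_1,L_2)$ is $(t_1,t_2)$-semistable. *)

theory Defs
  imports
    "HOL-Analysis.Analysis"
    "HOL-Library.Poly_Mapping"
    "HOL-Library.Numeral_Type"
    "HOL-Computational_Algebra.Factorial_Ring"
begin

text \<open>Polynomials over the complex numbers in variables indexed by \<open>'i\<close>. Forms on the plane have
  index type \<open>3\<close>, whose elements are \<open>0, 1, 2\<close>; local equations have index type \<open>2\<close>.\<close>

type_synonym 'i cpoly = "('i \<Rightarrow>\<^sub>0 nat) \<Rightarrow>\<^sub>0 complex"

definition pvar :: "'i \<Rightarrow> 'i cpoly" where
  "pvar i = Poly_Mapping.single (Poly_Mapping.single i 1) 1"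

definition pconst :: "complex \<Rightarrow> 'i cpoly" where
  "pconst c = Poly_Mapping.single 0 c"

definition psubst :: "('i::finite \<Rightarrow> 'j cpoly) \<Rightarrow> 'i cpoly \<Rightarrow> 'j cpoly" where
  "psubst \<sigma> F = (\<Sum>m\<in>Poly_Mapping.keys F.
     pconst (Poly_Mapping.lookup F m) * (\<Prod>i\<in>UNIV. \<sigma> i ^ Poly_Mapping.lookup m i))"

definition peval :: "'i::finite cpoly \<Rightarrow> complex ^ 'i \<Rightarrow> complex" where
  "peval F x = (\<Sum>m\<in>Poly_Mapping.keys F.
     Poly_Mapping.lookup F m * (\<Prod>i\<in>UNIV. (x $ i) ^ Poly_Mapping.lookup m i))"

text \<open>Below, the exponent subtraction is truncated, but where it truncates the coefficient is \<open>0\<close>.\<close>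

definition ppartial :: "'i \<Rightarrow> 'i cpoly \<Rightarrow> 'i cpoly" where
  "ppartial i F = (\<Sum>m\<in>Poly_Mapping.keys F.
     Poly_Mapping.single (m - Poly_Mapping.single i 1)
       (of_nat (Poly_Mapping.lookup m i) * Poly_Mapping.lookup F m))"

definition pgrad :: "'i::finite cpoly \<Rightarrow> complex ^ 'i \<Rightarrow> complex ^ 'i" where
  "pgrad F x = (\<chi> i. peval (ppartial i F) x)"

definition singular_zeros :: "'i::finite cpoly \<Rightarrow> (complex ^ 'i) set" where
  "singular_zeros F = {x. peval F x = 0 \<and> pgrad F x = 0}"


text \<open>A plane curve is given by an equation, that is, a nonzero form; lines are plane curves of
  degree \<open>1\<close>. Points of the plane are nonzero vectors up to \<open>same_point\<close>.\<close>

definition plane_curve :: "nat \<Rightarrow> 3 cpoly \<Rightarrow> bool" where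
  "plane_curve d F \<longleftrightarrow>
     F \<noteq> 0 \<and> (\<forall>m\<in>Poly_Mapping.keys F. (\<Sum>i\<in>UNIV. Poly_Mapping.lookup m i) = d)"

definition same_point :: "complex ^ 3 \<Rightarrow> complex ^ 3 \<Rightarrow> bool" where
  "same_point p q \<longleftrightarrow> (\<exists>c. c \<noteq> 0 \<and> q = c *s p)"

definition only_singular_point :: "3 cpoly \<Rightarrow> complex ^ 3 \<Rightarrow> bool" where
  "only_singular_point F p \<longleftrightarrow> p \<noteq> 0 \<and> p \<in> singular_zeros F \<and>
     (\<forall>q. q \<noteq> 0 \<and> q \<in> singular_zeros F \<longrightarrow> same_point p q)"

text \<open>The divisor \<open>H = 0\<close> has simple normal crossings at every point \<open>q\<close> other than \<open>p\<close>: the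
  equations of the irreducible components through \<open>q\<close>, counted with multiplicity, are part of a
  regular system of parameters at \<open>q\<close>, i.e. have linearly independent differentials there. (By
  Euler's formula the gradients of forms vanishing at \<open>q\<close> annihilate \<open>q\<close>, so independence can be
  tested on the homogeneous equations instead of in an affine chart.)\<close>

definition snc_away_from :: "complex ^ 3 \<Rightarrow> 3 cpoly \<Rightarrow> bool" where
  "snc_away_from p H \<longleftrightarrow>
     (\<forall>q Gs. q \<noteq> 0 \<and> \<not> same_point p q \<and>
        (\<forall>G\<in>set Gs. irreducible G \<and> peval G q = 0) \<and> prod_list Gs dvd H \<longrightarrow>
        (\<forall>c. (\<Sum>k<length Gs. c k *s pgrad (Gs ! k) q) = 0 \<longrightarrow> (\<forall>k<length Gs. c k = 0)))"


text \<open>For invertible \<open>g\<close> this is \<open>(g \<cdot> F)(x) = F (g\<^sup>-\<^sup>1 x)\<close>, which is also the equation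
  of the curve \<open>F = 0\<close> in the new homogeneous coordinates \<open>x = g y\<close>.\<close>

definition act :: "complex ^ 3 ^ 3 \<Rightarrow> 3 cpoly \<Rightarrow> 3 cpoly" where
  "act g F = psubst (\<lambda>i. \<Sum>j\<in>UNIV. pconst (matrix_inv g $ i $ j) * pvar j) F"

definition dehomogenize :: "3 cpoly \<Rightarrow> 2 cpoly" where
  "dehomogenize F = psubst (\<lambda>i. if i = 0 then pvar 0 else if i = 1 then pvar 1 else 1) F"

definition coords_at :: "complex ^ 3 ^ 3 \<Rightarrow> complex ^ 3 \<Rightarrow> bool" where
  "coords_at A p \<longleftrightarrow> invertible A \<and> same_point (axis 2 1) (A *v p)"

definition local_eq :: "complex ^ 3 ^ 3 \<Rightarrow> 3 cpoly \<Rightarrow> 2 cpoly" where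
  "local_eq A F = dehomogenize (act A F)"

definition mon_weight :: "real \<Rightarrow> real \<Rightarrow> (2 \<Rightarrow>\<^sub>0 nat) \<Rightarrow> real" where
  "mon_weight w1 w2 m =
     w1 * real (Poly_Mapping.lookup m 0) + w2 * real (Poly_Mapping.lookup m 1)"

definition wdeg :: "real \<Rightarrow> real \<Rightarrow> 2 cpoly \<Rightarrow> real" where
  "wdeg w1 w2 f = Min (mon_weight w1 w2 ` Poly_Mapping.keys f)"

definition lowest_part :: "real \<Rightarrow> real \<Rightarrow> 2 cpoly \<Rightarrow> 2 cpoly" where
  "lowest_part w1 w2 f =
     (\<Sum>m\<in>{m \<in> Poly_Mapping.keys f. mon_weight w1 w2 m = wdeg w1 w2 f}.
        Poly_Mapping.single m (Poly_Mapping.lookup f m))"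

definition semi_quasihomogeneous :: "real \<Rightarrow> real \<Rightarrow> 2 cpoly \<Rightarrow> bool" where
  "semi_quasihomogeneous w1 w2 f \<longleftrightarrow>
     0 isolated_in singular_zeros (lowest_part w1 w2 f)"

text \<open>The point \<open>p\<close> of \<open>F = 0\<close> is linearly semi-quasihomogeneous with respect to \<open>(w1, w2)\<close> iff
  some \<open>A\<close> satisfies the following predicate.\<close>

definition lin_sqh_in_coords ::
    "real \<Rightarrow> real \<Rightarrow> 3 cpoly \<Rightarrow> complex ^ 3 \<Rightarrow> complex ^ 3 ^ 3 \<Rightarrow> bool" where
  "lin_sqh_in_coords w1 w2 F p A \<longleftrightarrow>
     coords_at A p \<and> semi_quasihomogeneous w1 w2 (local_eq A F)"


text \<open>The exponents \<open>(r\<^sub>0, r\<^sub>1, r\<^sub>2)\<close> of a normalized one-parameter subgroup.\<close>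

definition normalized_1ps :: "int ^ 3 \<Rightarrow> bool" where
  "normalized_1ps r \<longleftrightarrow> r $ 0 + r $ 1 + r $ 2 = 0 \<and> r $ 0 \<ge> r $ 1 \<and> r $ 1 \<ge> r $ 2 \<and> r \<noteq> 0"

definition mu :: "3 cpoly \<Rightarrow> int ^ 3 \<Rightarrow> int" where
  "mu F r = Min ((\<lambda>m. \<Sum>i\<in>UNIV. int (Poly_Mapping.lookup m i) * r $ i) ` Poly_Mapping.keys F)"

definition mu_t :: "rat \<Rightarrow> rat \<Rightarrow> 3 cpoly \<Rightarrow> 3 cpoly \<Rightarrow> 3 cpoly \<Rightarrow> int ^ 3 \<Rightarrow> rat" where
  "mu_t t1 t2 F l1 l2 r = of_int (mu F r) + t1 * of_int (mu l1 r) + t2 * of_int (mu l2 r)"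

definition semistable :: "rat \<Rightarrow> rat \<Rightarrow> 3 cpoly \<Rightarrow> 3 cpoly \<Rightarrow> 3 cpoly \<Rightarrow> bool" where
  "semistable t1 t2 F l1 l2 \<longleftrightarrow>
     (\<forall>g r. det g = 1 \<and> normalized_1ps r \<longrightarrow> mu_t t1 t2 (act g F) (act g l1) (act g l2) r \<le> 0)"

definition Stab_all :: "nat \<Rightarrow> (rat \<times> rat) set" where
  "Stab_all d = {(t1, t2). t1 \<ge> 0 \<and> t2 \<ge> 0 \<and>
     (\<exists>F l1 l2. plane_curve d F \<and> plane_curve 1 l1 \<and> plane_curve 1 l2 \<and>
        semistable t1 t2 F l1 l2)}"

definition Stab :: "nat \<Rightarrow> 3 cpoly \<Rightarrow> 3 cpoly \<Rightarrow> 3 cpoly \<Rightarrow> (rat \<times> rat) set" where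
  "Stab d F l1 l2 = {(t1, t2) \<in> Stab_all d. semistable t1 t2 F l1 l2}"

end

theory Submission
  imports Defs
begin

text \<open>Integer weights \<open>n1 \<ge> n2 > 0\<close> give the normalized one-parameter subgroup with exponents
  \<open>(2 n1 - n2, 2 n2 - n1, - n1 - n2)\<close>. On forms of degree \<open>d\<close> in the coordinates adapted to \<open>p\<close> its
  weight is \<open>3\<close> times the local weighted degree minus \<open>d (n1 + n2)\<close>; on a line it is at least
  \<open>- n1 - n2\<close>, and at least \<open>2 n2 - n1\<close> if the line passes through \<open>p\<close>. Semistability is then
  the claimed inequality. Real weights are replaced by the integers \<open>\<lceil>N w1\<rceil>\<close> and \<open>\<lceil>N w2\<rceil>\<close> with
  \<open>N\<close> tending to infinity; rounding up can only increase the weighted degree.\<close>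

section \<open>Forms and linear substitutions\<close>

definition homogeneous :: "nat \<Rightarrow> 'i::finite cpoly \<Rightarrow> bool" where
  "homogeneous d F \<longleftrightarrow> (\<forall>m\<in>Poly_Mapping.keys F. (\<Sum>i\<in>UNIV. Poly_Mapping.lookup m i) = d)"

lemma plane_curve_iff: "plane_curve d F \<longleftrightarrow> F \<noteq> 0 \<and> homogeneous d F"
  by (simp add: plane_curve_def homogeneous_def)

lemma homogeneous_pconst [simp]: "homogeneous 0 (pconst c)"
  by (simp add: homogeneous_def pconst_def)

lemma homogeneous_pvar: "homogeneous 1 (pvar i)"
proof -
  have "(\<Sum>j\<in>UNIV. Poly_Mapping.lookup (Poly_Mapping.single i (1::nat)) j) = 1"
    by (simp add: lookup_single when_def)
  then show ?thesis
    by (simp add: homogeneous_def pvar_def)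
qed

lemma homogeneous_mult:
  assumes "homogeneous a F" "homogeneous b G"
  shows "homogeneous (a + b) (F * G)"
  unfolding homogeneous_def
proof
  fix m assume "m \<in> Poly_Mapping.keys (F * G)"
  then obtain u v where "m = u + v" "u \<in> Poly_Mapping.keys F" "v \<in> Poly_Mapping.keys G"
    using keys_mult[of F G] by blast
  then show "(\<Sum>i\<in>UNIV. Poly_Mapping.lookup m i) = a + b"
    using assms by (simp add: homogeneous_def lookup_add sum.distrib)
qed

lemma homogeneous_sum:
  assumes "\<And>k. k \<in> K \<Longrightarrow> homogeneous d (G k)"
  shows "homogeneous d (sum G K)"
  using assms keys_sum[of G K] unfolding homogeneous_def by blast

lemma homogeneous_one: "homogeneous 0 1"
  by (simp add: homogeneous_def)

lemma homogeneous_prod: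
  assumes "finite K" "\<And>k. k \<in> K \<Longrightarrow> homogeneous (e k) (G k)"
  shows "homogeneous (sum e K) (prod G K)"
  using assms by (induction K rule: finite_induct) (auto simp: homogeneous_one intro: homogeneous_mult)

lemma homogeneous_power:
  assumes "homogeneous a F"
  shows "homogeneous (a * n) (F ^ n)"
proof (induction n)
  case (Suc n)
  then show ?case
    using homogeneous_mult[OF assms Suc.IH] by (simp add: algebra_simps)
qed (simp add: homogeneous_one)

text \<open>Linear forms replace the variables, so each monomial of degree \<open>d\<close> turns
  into a constant times a product of \<open>d\<close> linear forms.\<close>

lemma homogeneous_psubst:
  assumes F: "homogeneous d F" and \<sigma>: "\<And>i. homogeneous 1 (\<sigma> i)"
  shows "homogeneous d (psubst \<sigma> F)"
  unfolding psubst_def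
proof (rule homogeneous_sum)
  fix m assume m: "m \<in> Poly_Mapping.keys F"
  have "homogeneous (0 + (\<Sum>i\<in>UNIV. 1 * Poly_Mapping.lookup m i))
     (pconst (Poly_Mapping.lookup F m) * (\<Prod>i\<in>UNIV. \<sigma> i ^ Poly_Mapping.lookup m i))"
    by (intro homogeneous_mult homogeneous_pconst homogeneous_prod homogeneous_power \<sigma>) simp
  then show "homogeneous d
     (pconst (Poly_Mapping.lookup F m) * (\<Prod>i\<in>UNIV. \<sigma> i ^ Poly_Mapping.lookup m i))"
    using F m by (simp add: homogeneous_def[of d F])
qed

lemma homogeneous_linear: "homogeneous 1 (\<Sum>j\<in>UNIV. pconst (c j) * pvar j)"
  using homogeneous_mult[OF homogeneous_pconst homogeneous_pvar]
  by (intro homogeneous_sum) simp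

lemma homogeneous_act: "homogeneous d F \<Longrightarrow> homogeneous d (act g F)"
  unfolding act_def by (intro homogeneous_psubst homogeneous_linear)

section \<open>Rescaling a coordinate change by a nonzero scalar\<close>

lemma pconst_mult: "pconst (a * b) = pconst a * pconst b"
  by (simp add: pconst_def mult_single)

lemma pconst_one: "pconst 1 = 1"
  by (simp add: pconst_def)

lemma pconst_power: "pconst (a ^ n) = pconst a ^ n"
  by (induction n) (simp_all add: pconst_one pconst_mult)

lemma lookup_pconst_mult:
  "Poly_Mapping.lookup (pconst c * F) m = c * Poly_Mapping.lookup F m"
proof -
  have "pconst c * F = Poly_Mapping.map ((*) c) F"
    by (simp add: mult_map_scale_conv_mult pconst_def)
  then show ?thesis
    by (simp add: Poly_Mapping.map.rep_eq when_def)
qed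

text \<open>Every monomial has total degree \<open>d\<close>, so all of them pick up the same factor
  \<open>c ^ d\<close>.\<close>

lemma psubst_scale:
  assumes "homogeneous d F"
  shows "psubst (\<lambda>i. pconst c * \<sigma> i) F = pconst (c ^ d) * psubst \<sigma> F"
  unfolding psubst_def sum_distrib_left
proof (rule sum.cong)
  fix m assume "m \<in> Poly_Mapping.keys F"
  then have d: "(\<Sum>i\<in>UNIV. Poly_Mapping.lookup m i) = d"
    using assms by (simp add: homogeneous_def)
  have "(\<Prod>i\<in>UNIV. (pconst c * \<sigma> i) ^ Poly_Mapping.lookup m i)
      = pconst (c ^ d) * (\<Prod>i\<in>UNIV. \<sigma> i ^ Poly_Mapping.lookup m i)"
    unfolding power_mult_distrib prod.distrib power_sum[symmetric] d pconst_power ..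
  then show "pconst (Poly_Mapping.lookup F m)
        * (\<Prod>i\<in>UNIV. (pconst c * \<sigma> i) ^ Poly_Mapping.lookup m i)
      = pconst (c ^ d) * (pconst (Poly_Mapping.lookup F m)
        * (\<Prod>i\<in>UNIV. \<sigma> i ^ Poly_Mapping.lookup m i))"
    by (simp add: mult_ac)
qed simp

lemma matrix_inv_both:
  fixes A :: "'a::field ^ 'n ^ 'n"
  assumes "invertible A"
  shows "A ** matrix_inv A = mat 1" "matrix_inv A ** A = mat 1"
  using someI_ex[of "\<lambda>A'. A ** A' = mat 1 \<and> A' ** A = mat 1"] assms
  unfolding invertible_def matrix_inv_def by auto

text \<open>\<open>matrix_inv\<close> is a choice among two-sided inverses, so its entries cannot be
  computed directly. The rescaled inverse is checked to be an inverse, and uniqueness identifies it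
  with the chosen one.\<close>

lemma matrix_inv_scale:
  fixes A :: "'a::field ^ 'n ^ 'n"
  assumes A: "invertible A" and c: "c \<noteq> 0"
  shows "matrix_inv (\<chi> i. c *s A $ i) $ i $ j = inverse c * matrix_inv A $ i $ j"
proof -
  define B where "B = (\<chi> i. c *s A $ i)"
  define B' where "B' = (\<chi> i. inverse c *s matrix_inv A $ i)"
  have "B ** B' = A ** matrix_inv A"
    using c by (auto simp: B_def B'_def matrix_matrix_mult_def vec_eq_iff intro!: sum.cong)
  then have BB': "B ** B' = mat 1"
    by (simp add: matrix_inv_both[OF A])
  then have "B' ** B = mat 1"
    using matrix_left_right_inverse by blast
  with BB' have "invertible B"
    by (auto simp: invertible_def)
  then have "matrix_inv B = B'"
    by (metis BB' matrix_inv_both(2) matrix_mul_assoc matrix_mul_lid matrix_mul_rid)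
  then show ?thesis
    by (simp add: B_def B'_def)
qed

lemma act_scale:
  assumes "homogeneous d F" "invertible g" "c \<noteq> 0"
  shows "act (\<chi> i. c *s g $ i) F = pconst (inverse c ^ d) * act g F"
proof -
  have "(\<lambda>i. \<Sum>j\<in>UNIV. pconst (matrix_inv (\<chi> i. c *s g $ i) $ i $ j) * pvar j)
      = (\<lambda>i. pconst (inverse c) * (\<Sum>j\<in>UNIV. pconst (matrix_inv g $ i $ j) * pvar j))"
    by (simp add: matrix_inv_scale[OF assms(2,3)] pconst_mult sum_distrib_left mult.assoc)
  then show ?thesis
    unfolding act_def using psubst_scale[OF assms(1)] by simp
qed

text \<open>The rescaling multiplies the form by a nonzero constant. The set of monomials is all
  that \<open>mu\<close> depends on.\<close>

lemma keys_act_scale: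
  assumes "homogeneous d F" "invertible g" "c \<noteq> 0"
  shows "Poly_Mapping.keys (act (\<chi> i. c *s g $ i) F) = Poly_Mapping.keys (act g F)"
  using assms by (auto simp: act_scale in_keys_iff lookup_pconst_mult)

lemma mu_act_scale:
  assumes "homogeneous d F" "invertible g" "c \<noteq> 0"
  shows "mu (act (\<chi> i. c *s g $ i) F) r = mu (act g F) r"
  unfolding mu_def keys_act_scale[OF assms] ..

text \<open>Every invertible matrix is a scalar multiple of one of determinant \<open>1\<close>, and scalars do not
  change the monomials of a form.\<close>

lemma semistable_invertible:
  assumes "semistable t1 t2 F l1 l2" and "invertible g" and "normalized_1ps r"
    and "homogeneous d F" "homogeneous d1 l1" "homogeneous d2 l2"
  shows "mu_t t1 t2 (act g F) (act g l1) (act g l2) r \<le> 0"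
proof -
  \<comment> \<open>Scaling a 3 by 3 matrix by \<open>c\<close> multiplies its determinant by the
    cube of \<open>c\<close>; hence the cube root.\<close>
  obtain c :: complex where c: "inverse (det g) = c ^ 3"
    using exists_complex_root[of 3] by auto
  have "det g \<noteq> 0"
    using assms(2) invertible_det_nz by blast
  then have "c \<noteq> 0"
    using c by (metis inverse_nonzero_iff_nonzero power_zero_numeral)
  have "det (\<chi> i. c *s g $ i) = 1"
    using \<open>det g \<noteq> 0\<close> c[symmetric] det_rows_mul[of "\<lambda>_. c" "($) g"] by simp
  then have "mu_t t1 t2 (act (\<chi> i. c *s g $ i) F) (act (\<chi> i. c *s g $ i) l1)
      (act (\<chi> i. c *s g $ i) l2) r \<le> 0"
    using assms unfolding semistable_def by blast
  then show ?thesis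
    using assms \<open>c \<noteq> 0\<close> by (simp add: mu_t_def mu_act_scale)
qed

section \<open>Lines\<close>

lemma sum_eq_one_single:
  fixes m :: "'i::finite \<Rightarrow>\<^sub>0 nat"
  assumes "(\<Sum>i\<in>UNIV. Poly_Mapping.lookup m i) = 1"
  obtains i where "m = Poly_Mapping.single i 1"
proof -
  obtain i where i: "Poly_Mapping.lookup m i \<noteq> 0"
    using assms by (metis sum.neutral zero_neq_one)
  have "(\<Sum>j\<in>UNIV. Poly_Mapping.lookup m j)
      = Poly_Mapping.lookup m i + (\<Sum>j\<in>UNIV - {i}. Poly_Mapping.lookup m j)"
    by (simp add: sum.remove[of UNIV i])
  then have "Poly_Mapping.lookup m i = 1" "(\<Sum>j\<in>UNIV - {i}. Poly_Mapping.lookup m j) = 0"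
    using assms i by linarith+
  then have "Poly_Mapping.lookup m i = 1" "\<forall>j\<in>UNIV - {i}. Poly_Mapping.lookup m j = 0"
    by simp_all
  then have "m = Poly_Mapping.single i 1"
    by (intro poly_mapping_eqI) (auto simp: lookup_single when_def)
  then show ?thesis ..
qed

lemma keys_homogeneous_1:
  assumes "homogeneous 1 l"
  shows "Poly_Mapping.keys l \<subseteq> range (\<lambda>i. Poly_Mapping.single i 1)"
proof
  fix m assume "m \<in> Poly_Mapping.keys l"
  then have "(\<Sum>i\<in>UNIV. Poly_Mapping.lookup m i) = 1"
    using assms by (simp add: homogeneous_def)
  then show "m \<in> range (\<lambda>i. Poly_Mapping.single i 1)"
    using sum_eq_one_single by blast
qed

lemma inj_single_one: "inj (\<lambda>i. Poly_Mapping.single i (1::nat))"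
  by (rule injI) (metis lookup_single_eq lookup_single_not_eq zero_neq_one)

lemma prod_power_single:
  fixes x :: "'i::finite \<Rightarrow> 'a::comm_semiring_1"
  shows "(\<Prod>j\<in>UNIV. x j ^ Poly_Mapping.lookup (Poly_Mapping.single i 1) j) = x i"
proof -
  have "(\<Prod>j\<in>UNIV. x j ^ Poly_Mapping.lookup (Poly_Mapping.single i 1) j)
      = (\<Prod>j\<in>UNIV. if i = j then x j else 1)"
    by (intro prod.cong) (auto simp: lookup_single when_def)
  then show ?thesis
    by simp
qed

text \<open>The condition on \<open>h\<close> lets absent variables contribute nothing, so the sum
  can run over all variables. Keeping \<open>h\<close> general serves both substitution and
  evaluation.\<close>

lemma sum_keys_linear:
  fixes l :: "'i::finite cpoly" and h :: "('i \<Rightarrow>\<^sub>0 nat) \<Rightarrow> complex \<Rightarrow> 'a::comm_monoid_add"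
  assumes "homogeneous 1 l" and "\<And>m. h m 0 = 0"
  shows "(\<Sum>m\<in>Poly_Mapping.keys l. h m (Poly_Mapping.lookup l m))
    = (\<Sum>i\<in>UNIV. h (Poly_Mapping.single i 1) (Poly_Mapping.lookup l (Poly_Mapping.single i 1)))"
proof -
  have "(\<Sum>m\<in>Poly_Mapping.keys l. h m (Poly_Mapping.lookup l m))
      = (\<Sum>m\<in>range (\<lambda>i. Poly_Mapping.single i 1). h m (Poly_Mapping.lookup l m))"
    using keys_homogeneous_1[OF assms(1)] assms(2)
    by (intro sum.mono_neutral_left) (auto simp: in_keys_iff)
  also have "\<dots> = (\<Sum>i\<in>UNIV. h (Poly_Mapping.single i 1)
      (Poly_Mapping.lookup l (Poly_Mapping.single i 1)))"
    by (subst sum.reindex[OF inj_single_one]) simp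
  finally show ?thesis .
qed

lemma psubst_linear:
  assumes "homogeneous 1 l"
  shows "psubst \<sigma> l = (\<Sum>i\<in>UNIV. pconst (Poly_Mapping.lookup l (Poly_Mapping.single i 1)) * \<sigma> i)"
  unfolding psubst_def
  by (subst sum_keys_linear[OF assms, where h = "\<lambda>m c. pconst c * (\<Prod>i\<in>UNIV. \<sigma> i ^ Poly_Mapping.lookup m i)"])
    (simp_all add: pconst_def prod_power_single del: One_nat_def)

lemma peval_linear:
  assumes "homogeneous 1 l"
  shows "peval l x = (\<Sum>i\<in>UNIV. Poly_Mapping.lookup l (Poly_Mapping.single i 1) * x $ i)"
  unfolding peval_def
  by (subst sum_keys_linear[OF assms, where h = "\<lambda>m c. c * (\<Prod>i\<in>UNIV. (x $ i) ^ Poly_Mapping.lookup m i)"])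
    (simp_all add: prod_power_single del: One_nat_def)

lemma lookup_pvar: "Poly_Mapping.lookup (pvar i) (Poly_Mapping.single j 1) = (if i = j then 1 else 0)"
  unfolding pvar_def using inj_single_one[THEN inj_eq, of i j]
  by (auto simp: lookup_single when_def)

text \<open>The coefficient vector of a linear form transforms as a row vector, by right
  multiplication with the inverse matrix.\<close>

lemma lookup_act_linear:
  assumes "homogeneous 1 l"
  shows "Poly_Mapping.lookup (act g l) (Poly_Mapping.single j 1)
    = (\<Sum>i\<in>UNIV. Poly_Mapping.lookup l (Poly_Mapping.single i 1) * matrix_inv g $ i $ j)"
proof -
  have *: "(\<Sum>k\<in>UNIV. b k * (if k = j then 1 else 0)) = b j" for b :: "3 \<Rightarrow> complex"
  proof -
    have "(\<Sum>k\<in>UNIV. b k * (if k = j then 1 else 0)) = (\<Sum>k\<in>UNIV. if k = j then b k else 0)"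
      by (intro sum.cong) auto
    then show ?thesis
      by simp
  qed
  show ?thesis
    by (simp add: act_def psubst_linear[OF assms] lookup_sum lookup_pconst_mult lookup_pvar *
        del: One_nat_def)
qed

text \<open>Nonvanishing is needed before speaking of \<open>mu\<close>, because \<open>Min\<close>
  of the empty set is unspecified. Multiplying the row of coefficients by \<open>g\<close> undoes
  the transformation.\<close>

lemma act_line_nonzero:
  assumes l: "plane_curve 1 l" and g: "invertible g"
  shows "act g l \<noteq> 0"
proof
  assume "act g l = 0"
  define a where "a = (\<chi> i. Poly_Mapping.lookup l (Poly_Mapping.single i 1))"
  have hom: "homogeneous 1 l" and "l \<noteq> 0"
    using l by (simp_all add: plane_curve_iff)
  have "a v* matrix_inv g = 0"
    using lookup_act_linear[OF hom, of g] \<open>act g l = 0\<close>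
    by (simp add: vector_matrix_mult_def a_def vec_eq_iff mult.commute)
  then have "a v* (matrix_inv g ** g) = 0"
    by (metis vector_matrix_mul_assoc vector_matrix_mult_0)
  then have "a = 0"
    by (simp add: matrix_inv_both[OF g])
  then have "Poly_Mapping.keys l = {}"
    using keys_homogeneous_1[OF hom] unfolding a_def vec_eq_iff
    by (auto simp del: One_nat_def keys_eq_empty)
  with \<open>l \<noteq> 0\<close> show False
    by simp
qed

text \<open>As \<open>A\<close> sends \<open>p\<close> to a multiple of the last basis vector, the
  inverse sends that basis vector, whose image is the last column, back to a multiple of
  \<open>p\<close>.\<close>

lemma coords_at_column:
  assumes "coords_at A p"
  obtains c where "c \<noteq> 0" "\<And>i. p $ i = c * matrix_inv A $ i $ 2"
proof -
  from assms obtain c where c: "c \<noteq> 0" "A *v p = c *s axis 2 1" and inv: "invertible A"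
    by (auto simp: coords_at_def same_point_def)
  have column: "matrix_inv A *v axis 2 1 = column 2 (matrix_inv A)"
    by (simp add: matrix_vector_mult_def column_def axis_def if_distrib[of "(*) _"] cong: if_cong)
  have "p = matrix_inv A *v (A *v p)"
    by (simp add: matrix_vector_mul_assoc matrix_inv_both[OF inv])
  also have "\<dots> = c *s column 2 (matrix_inv A)"
    by (simp add: c vector_scalar_commute column)
  finally have "\<And>i. p $ i = c * matrix_inv A $ i $ 2"
    by (simp add: column_def vec_eq_iff)
  with c(1) show ?thesis ..
qed

section \<open>Weights of lines under a one-parameter subgroup\<close>

lemma mu_attained:
  assumes "F \<noteq> 0"
  obtains m where "m \<in> Poly_Mapping.keys F"
    "mu F r = (\<Sum>i\<in>UNIV. int (Poly_Mapping.lookup m i) * r $ i)"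
proof -
  have "mu F r \<in> (\<lambda>m. \<Sum>i\<in>UNIV. int (Poly_Mapping.lookup m i) * r $ i) ` Poly_Mapping.keys F"
    unfolding mu_def using assms by (intro Min_in) auto
  then show ?thesis
    using that by blast
qed

text \<open>The monomials of a linear form are single variables, so its weight is one of the
  exponents of the subgroup.\<close>

lemma mu_line_attained:
  assumes "homogeneous 1 l" "l \<noteq> 0"
  obtains i where "Poly_Mapping.lookup l (Poly_Mapping.single i 1) \<noteq> 0" "mu l r = r $ i"
proof -
  obtain m where m: "m \<in> Poly_Mapping.keys l"
    "mu l r = (\<Sum>i\<in>UNIV. int (Poly_Mapping.lookup m i) * r $ i)"
    using mu_attained[OF assms(2)] .
  then obtain i where i: "m = Poly_Mapping.single i 1"
    using keys_homogeneous_1[OF assms(1)] by blast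
  have "mu l r = (\<Sum>j\<in>UNIV. if i = j then r $ j else 0)"
    unfolding m(2) i by (intro sum.cong) (auto simp: lookup_single when_def)
  then have "mu l r = r $ i"
    by simp
  moreover have "Poly_Mapping.lookup l (Poly_Mapping.single i 1) \<noteq> 0"
    using m(1) i by (simp add: in_keys_iff)
  ultimately show ?thesis
    using that by blast
qed

lemma cases_3: "i = 0 \<or> i = 1 \<or> i = (2::3)"
  using exhaust_3[of i] by auto

lemma mu_line_ge:
  assumes "plane_curve 1 l" "invertible g" "normalized_1ps r"
  shows "r $ 2 \<le> mu (act g l) r"
proof -
  have "homogeneous 1 (act g l)" "act g l \<noteq> 0"
    using assms act_line_nonzero by (auto simp: plane_curve_iff intro: homogeneous_act)
  then obtain i where "mu (act g l) r = r $ i"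
    using mu_line_attained by blast
  then show ?thesis
    using assms(3) cases_3[of i] by (auto simp: normalized_1ps_def)
qed

text \<open>A line through \<open>p\<close> has no \<open>x2\<close> term in coordinates adapted to
  \<open>p\<close>, so the smallest exponent \<open>r $ 2\<close> cannot be its weight.\<close>

lemma mu_line_through_ge:
  assumes "plane_curve 1 l" "coords_at g p" "peval l p = 0" "normalized_1ps r"
  shows "r $ 1 \<le> mu (act g l) r"
proof -
  have hom: "homogeneous 1 l" and g: "invertible g"
    using assms by (auto simp: plane_curve_iff coords_at_def)
  have "homogeneous 1 (act g l)" "act g l \<noteq> 0"
    using assms g act_line_nonzero by (auto simp: plane_curve_iff intro: homogeneous_act)
  then obtain i where i: "mu (act g l) r = r $ i"
    "Poly_Mapping.lookup (act g l) (Poly_Mapping.single i 1) \<noteq> 0"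
    using mu_line_attained by blast
  obtain c where c: "c \<noteq> 0" "\<And>i. p $ i = c * matrix_inv g $ i $ 2"
    using coords_at_column[OF assms(2)] by blast
  \<comment> \<open>The new coefficient of \<open>x2\<close> is \<open>l\<close> evaluated on the
    last column of the inverse matrix, which is \<open>p\<close> up to the factor
    \<open>c\<close>.\<close>
  have "peval l p = c * Poly_Mapping.lookup (act g l) (Poly_Mapping.single 2 1)"
    by (simp add: peval_linear[OF hom] lookup_act_linear[OF hom] c(2) sum_distrib_left mult_ac
        del: One_nat_def)
  with assms(3) c(1) i(2) have "i \<noteq> 2"
    by auto
  then show ?thesis
    using assms(4) cases_3[of i] i(1) by (auto simp: normalized_1ps_def)
qed

section \<open>Local equations\<close>

definition affine_part :: "(3 \<Rightarrow>\<^sub>0 nat) \<Rightarrow> (2 \<Rightarrow>\<^sub>0 nat)" where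
  "affine_part m = Poly_Mapping.single 0 (Poly_Mapping.lookup m 0)
     + Poly_Mapping.single 1 (Poly_Mapping.lookup m 1)"

lemma lookup_affine_part [simp]:
  "Poly_Mapping.lookup (affine_part m) 0 = Poly_Mapping.lookup m 0"
  "Poly_Mapping.lookup (affine_part m) 1 = Poly_Mapping.lookup m 1"
  by (simp_all add: affine_part_def lookup_add lookup_single)

lemma sum_3': "(\<Sum>i\<in>UNIV. f (i::3)) = f 0 + f 1 + f 2" for f :: "3 \<Rightarrow> 'a::comm_monoid_add"
proof -
  \<comment> \<open>Indices are taken modulo 3, so the index \<open>3\<close> used by
    \<open>sum_3\<close> is the index \<open>0\<close> here.\<close>
  have "(3 :: 3) = 0"
    by simp
  then show ?thesis
    using sum_3[of f] by (simp only: ac_simps)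
qed

lemma prod_3': "(\<Prod>i\<in>UNIV. f (i::3)) = f 0 * f 1 * f 2" for f :: "3 \<Rightarrow> 'a::comm_monoid_mult"
proof -
  have "(3 :: 3) = 0"
    by simp
  moreover have "prod f UNIV = f 1 * f 2 * f 3"
    unfolding UNIV_3 by (simp add: mult.assoc)
  ultimately show ?thesis
    by (simp only: ac_simps)
qed

text \<open>The fixed total degree recovers the exponent of \<open>x2\<close> from the other
  two.\<close>

lemma inj_on_affine_part:
  assumes "homogeneous d F"
  shows "inj_on affine_part (Poly_Mapping.keys F)"
proof (rule inj_onI)
  fix m n assume "m \<in> Poly_Mapping.keys F" "n \<in> Poly_Mapping.keys F" and eq: "affine_part m = affine_part n"
  then have "(\<Sum>i\<in>UNIV. Poly_Mapping.lookup m i) = (\<Sum>i\<in>UNIV. Poly_Mapping.lookup n i)"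
    using assms by (simp add: homogeneous_def)
  moreover have "Poly_Mapping.lookup m 0 = Poly_Mapping.lookup n 0"
      "Poly_Mapping.lookup m 1 = Poly_Mapping.lookup n 1"
    using eq lookup_affine_part by metis+
  ultimately have "Poly_Mapping.lookup m i = Poly_Mapping.lookup n i" for i
    using cases_3[of i] by (auto simp: sum_3')
  then show "m = n"
    by (rule poly_mapping_eqI)
qed

lemma pvar_power: "pvar i ^ n = Poly_Mapping.single (Poly_Mapping.single i n) 1"
  by (induction n) (simp_all add: pvar_def mult_single single_add[symmetric])

lemma dehomogenize_eq:
  "dehomogenize F = (\<Sum>m\<in>Poly_Mapping.keys F.
     Poly_Mapping.single (affine_part m) (Poly_Mapping.lookup F m))"
  unfolding dehomogenize_def psubst_def
  by (intro sum.cong) (simp_all add: prod_3' pvar_power pconst_def mult_single affine_part_def)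

text \<open>Distinct monomials stay distinct after setting \<open>x2 = 1\<close>, so no coefficients
  cancel.\<close>

lemma affine_part_in_keys:
  assumes "homogeneous d F" "m \<in> Poly_Mapping.keys F"
  shows "affine_part m \<in> Poly_Mapping.keys (dehomogenize F)"
proof -
  have "Poly_Mapping.lookup (dehomogenize F) (affine_part m)
      = (\<Sum>n\<in>Poly_Mapping.keys F. if n = m then Poly_Mapping.lookup F n else 0)"
    unfolding dehomogenize_eq lookup_sum
    using inj_onD[OF inj_on_affine_part[OF assms(1)] _ _ assms(2)]
    by (intro sum.cong) (auto simp: lookup_single when_def)
  then show ?thesis
    using assms(2) by (simp add: in_keys_iff)
qed

text \<open>For the zero polynomial every point is a singular zero, and the complex plane has no
  isolated points.\<close>

lemma semi_quasihomogeneous_nonzero: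
  assumes "semi_quasihomogeneous w1 w2 f"
  shows "f \<noteq> 0"
proof
  assume "f = 0"
  then have "singular_zeros (lowest_part w1 w2 f) = UNIV"
    by (auto simp: lowest_part_def singular_zeros_def peval_def pgrad_def ppartial_def vec_eq_iff)
  with assms have "(0 :: complex ^ 2) isolated_in UNIV"
    by (simp add: semi_quasihomogeneous_def)
  then have "open {0 :: complex ^ 2}"
    by (auto simp: isolated_in_def)
  then show False
    by (simp add: not_open_singleton)
qed

section \<open>The one-parameter subgroup of a pair of weights\<close>

text \<open>This is \<open>3 * (n1, n2, 0)\<close> minus \<open>n1 + n2\<close> in every entry: the
  local weights, with weight 0 for \<open>x2\<close>, shifted to have sum 0 and tripled to stay
  integral.\<close>

definition weight_1ps :: "int \<Rightarrow> int \<Rightarrow> int ^ 3" where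
  "weight_1ps n1 n2 = (\<chi> i. if i = 0 then 2 * n1 - n2 else if i = 1 then 2 * n2 - n1 else - n1 - n2)"

lemma weight_1ps_nth [simp]:
  "weight_1ps n1 n2 $ 0 = 2 * n1 - n2"
  "weight_1ps n1 n2 $ 1 = 2 * n2 - n1"
  "weight_1ps n1 n2 $ 2 = - n1 - n2"
  by (simp_all add: weight_1ps_def)

lemma normalized_weight_1ps:
  assumes "n1 \<ge> n2" "n2 > 0"
  shows "normalized_1ps (weight_1ps n1 n2)"
proof -
  have "weight_1ps n1 n2 $ 2 \<noteq> 0"
    using assms by simp
  then have "weight_1ps n1 n2 \<noteq> 0"
    by force
  then show ?thesis
    using assms by (simp add: normalized_1ps_def)
qed

text \<open>A monomial attaining \<open>mu\<close> has an affine part of weight at least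
  \<open>wdeg\<close>. Its exponents are nonnegative, so enlarging \<open>N * w1\<close> and
  \<open>N * w2\<close> to integers preserves the lower bound; the shift in
  \<open>weight_1ps\<close> contributes the degree term.\<close>

lemma mu_weight_1ps_ge:
  fixes w1 w2 :: real
  assumes F: "homogeneous d F" "F \<noteq> 0"
    and le: "N * w1 \<le> of_int n1" "N * w2 \<le> of_int n2" and N: "N \<ge> 0"
  shows "3 * N * wdeg w1 w2 (dehomogenize F) - real d * of_int (n1 + n2)
    \<le> of_int (mu F (weight_1ps n1 n2))"
proof -
  obtain m where m: "m \<in> Poly_Mapping.keys F"
    and mu: "mu F (weight_1ps n1 n2) = (\<Sum>i\<in>UNIV. int (Poly_Mapping.lookup m i) * weight_1ps n1 n2 $ i)"
    using mu_attained[OF F(2)] .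
  define a b where "a = real (Poly_Mapping.lookup m 0)" and "b = real (Poly_Mapping.lookup m 1)"
  have d: "d = Poly_Mapping.lookup m 0 + Poly_Mapping.lookup m 1 + Poly_Mapping.lookup m 2"
    using F(1) m by (simp add: homogeneous_def sum_3')
  have "wdeg w1 w2 (dehomogenize F) \<le> mon_weight w1 w2 (affine_part m)"
    unfolding wdeg_def using affine_part_in_keys[OF F(1) m] by (intro Min_le) auto
  also have "\<dots> = w1 * a + w2 * b"
    by (simp add: mon_weight_def a_def b_def)
  finally have "N * wdeg w1 w2 (dehomogenize F) \<le> N * (w1 * a + w2 * b)"
    using N by (rule mult_left_mono)
  also have "\<dots> = (N * w1) * a + (N * w2) * b"
    by (simp add: algebra_simps)
  also have "\<dots> \<le> of_int n1 * a + of_int n2 * b"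
    using le by (intro add_mono mult_right_mono) (simp_all add: a_def b_def)
  finally have "3 * N * wdeg w1 w2 (dehomogenize F) \<le> 3 * (of_int n1 * a + of_int n2 * b)"
    by simp
  also have "\<dots> = of_int (mu F (weight_1ps n1 n2)) + real d * of_int (n1 + n2)"
    unfolding mu sum_3' d by (simp add: a_def b_def algebra_simps)
  finally show ?thesis
    by simp
qed

text \<open>\<open>\<alpha>\<close> and \<open>\<beta>\<close> describe a lower bound for the weight of the first line that is linear in the
  weights: \<open>(- 1, - 1)\<close> for an arbitrary line and \<open>(- 1, 2)\<close> for a line through \<open>p\<close>.\<close>

lemma semistable_weight_bound:
  fixes w1 w2 :: real and \<alpha> \<beta> :: int
  assumes F: "plane_curve d F" and l1: "plane_curve 1 l1" and l2: "plane_curve 1 l2"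
    and w: "w1 \<ge> w2" "w2 > 0" and A: "lin_sqh_in_coords w1 w2 F p A"
    and t: "t1 \<ge> 0" "t2 \<ge> 0" and ss: "semistable t1 t2 F l1 l2"
    and l1_ge: "\<And>n1 n2. \<lbrakk>n1 \<ge> n2; n2 > 0\<rbrakk> \<Longrightarrow>
      \<alpha> * n1 + \<beta> * n2 \<le> mu (act A l1) (weight_1ps n1 n2)"
  shows "3 * wdeg w1 w2 (local_eq A F) \<le> real d * (w1 + w2)
    - real_of_rat t1 * (\<alpha> * w1 + \<beta> * w2) + real_of_rat t2 * (w1 + w2)"
proof -
  have inv: "invertible A" and sqh: "semi_quasihomogeneous w1 w2 (local_eq A F)"
    using A by (auto simp: lin_sqh_in_coords_def coords_at_def)
  have hom: "homogeneous d F" "homogeneous 1 l1" "homogeneous 1 l2"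
    using F l1 l2 by (simp_all add: plane_curve_iff)
  have nz: "act A F \<noteq> 0"
    using semi_quasihomogeneous_nonzero[OF sqh]
    by (auto simp: local_eq_def dehomogenize_eq)
  define T1 T2 where "T1 = real_of_rat t1" and "T2 = real_of_rat t2"
  have T: "T1 \<ge> 0" "T2 \<ge> 0"
    using t by (simp_all add: T1_def T2_def)
  \<comment> \<open>These are the coefficients of \<open>n1\<close> and \<open>n2\<close> once
    semistability is combined with the lower bounds for the curve and both lines. The claim is then
    \<open>X \<le> 0\<close>.\<close>
  define p1 p2 where "p1 = real d + T2 - T1 * \<alpha>" and "p2 = real d + T2 - T1 * \<beta>"
  define X where "X = 3 * wdeg w1 w2 (local_eq A F) - (p1 * w1 + p2 * w2)"
  \<comment> \<open>The error made by rounding is bounded independently of \<open>N\<close>, while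
    the main term grows linearly.\<close>
  have bound: "real N * X \<le> \<bar>p1\<bar> + \<bar>p2\<bar>" if "N > 0" for N
  proof -
    define n1 n2 where "n1 = \<lceil>real N * w1\<rceil>" and "n2 = \<lceil>real N * w2\<rceil>"
    have n: "n1 \<ge> n2" "n2 > 0"
      using w that by (auto simp: n1_def n2_def intro!: ceiling_mono mult_left_mono)
    note r = normalized_weight_1ps[OF n]
    have le: "real N * w1 \<le> n1" "real N * w2 \<le> n2"
      by (simp_all add: n1_def n2_def)
    have ge: "n1 \<le> real N * w1 + 1" "n2 \<le> real N * w2 + 1"
      unfolding n1_def n2_def by linarith+
    define M0 M1 M2 where "M0 = mu (act A F) (weight_1ps n1 n2)"
      and "M1 = mu (act A l1) (weight_1ps n1 n2)" and "M2 = mu (act A l2) (weight_1ps n1 n2)"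
    have "mu_t t1 t2 (act A F) (act A l1) (act A l2) (weight_1ps n1 n2) \<le> 0"
      using semistable_invertible[OF ss inv r hom] .
    then have "real_of_rat (of_int M0 + t1 * of_int M1 + t2 * of_int M2) \<le> 0"
      by (simp add: mu_t_def M0_def M1_def M2_def)
    then have "of_int M0 + T1 * of_int M1 + T2 * of_int M2 \<le> 0"
      by (simp add: of_rat_add of_rat_mult T1_def T2_def)
    moreover have "3 * real N * wdeg w1 w2 (local_eq A F) - real d * of_int (n1 + n2) \<le> of_int M0"
      unfolding M0_def local_eq_def
      by (rule mu_weight_1ps_ge[OF homogeneous_act[OF hom(1)] nz le]) simp
    moreover have "T1 * of_int (\<alpha> * n1 + \<beta> * n2) \<le> T1 * of_int M1"
      using l1_ge[OF n] T by (intro mult_left_mono) (simp_all only: M1_def of_int_le_iff)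
    moreover have "T2 * of_int (- n1 - n2) \<le> T2 * of_int M2"
      using mu_line_ge[OF l2 inv r] T
      by (intro mult_left_mono) (simp_all only: M2_def of_int_le_iff weight_1ps_nth)
    ultimately have "3 * real N * wdeg w1 w2 (local_eq A F) \<le> p1 * n1 + p2 * n2"
      by (simp add: p1_def p2_def algebra_simps)
    also have "\<dots> = p1 * (real N * w1) + p2 * (real N * w2)
        + (p1 * (n1 - real N * w1) + p2 * (n2 - real N * w2))"
      by (simp add: algebra_simps)
    \<comment> \<open>The signs of \<open>p1\<close> and \<open>p2\<close> are unknown, so each
      rounding error in \<open>[0, 1]\<close> is estimated through an absolute value.\<close>
    also have "p1 * (n1 - real N * w1) \<le> \<bar>p1\<bar> * 1"
      using le ge by (intro mult_mono) auto
    also have "p2 * (n2 - real N * w2) \<le> \<bar>p2\<bar> * 1"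
      using le ge by (intro mult_mono) auto
    finally show ?thesis
      by (simp add: X_def algebra_simps)
  qed
  have "X \<le> 0"
  proof (rule ccontr)
    assume "\<not> X \<le> 0"
    \<comment> \<open>A positive \<open>X\<close> would have a multiple exceeding the uniform bound;
      \<open>N = 0\<close> is impossible because that bound is nonnegative.\<close>
    then obtain N where N: "\<bar>p1\<bar> + \<bar>p2\<bar> < real N * X"
      using reals_Archimedean3[of X] by auto
    then have "N > 0"
      by (cases N) auto
    from bound[OF this] N show False
      by linarith
  qed
  then show ?thesis
    by (simp add: X_def p1_def p2_def T1_def T2_def algebra_simps)
qed

theorem lemma2p11:
  fixes d :: nat and F l1 l2 :: "3 cpoly" and p :: "complex ^ 3"
    and A :: "complex ^ 3 ^ 3" and w1 w2 :: real
  assumes "plane_curve d F" and "plane_curve 1 l1" and "plane_curve 1 l2"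
    and "only_singular_point F p"
    and "w1 \<ge> w2" and "w2 > 0"
    and "lin_sqh_in_coords w1 w2 F p A"
    and "snc_away_from p (F * l1 * l2)"
  defines "f \<equiv> local_eq A F"
  shows "(peval l1 p \<noteq> 0 \<and> peval l2 p \<noteq> 0 \<longrightarrow>
            Stab d F l1 l2 \<subseteq> {(t1, t2) \<in> Stab_all d.
              real_of_rat t1 + real_of_rat t2 - 3 * wdeg w1 w2 f / (w1 + w2) + real d \<ge> 0})
       \<and> (peval l2 p \<noteq> 0 \<and> peval l1 p = 0 \<and> peval F p = 0 \<longrightarrow>
            Stab d F l1 l2 \<subseteq> {(t1, t2) \<in> Stab_all d.
              real_of_rat t2 - real_of_rat t1 * ((2 * w2 - w1) / (w1 + w2))
                - 3 * wdeg w1 w2 f / (w1 + w2) + real d \<ge> 0})"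
proof -
  have pos: "w1 + w2 > 0"
    using assms by simp
  have A: "coords_at A p" "invertible A"
    using assms(7) by (auto simp: lin_sqh_in_coords_def coords_at_def)
  note bound = semistable_weight_bound[OF assms(1,2,3,5,6,7), folded f_def]
  have 1: "real_of_rat t1 + real_of_rat t2 - 3 * wdeg w1 w2 f / (w1 + w2) + real d \<ge> 0"
    if t: "(t1, t2) \<in> Stab d F l1 l2" for t1 t2
  proof -
    have "3 * wdeg w1 w2 f \<le> real d * (w1 + w2)
        - real_of_rat t1 * ((- 1 :: int) * w1 + (- 1 :: int) * w2) + real_of_rat t2 * (w1 + w2)"
      using t mu_line_ge[OF assms(2) A(2) normalized_weight_1ps]
      by (intro bound) (auto simp: Stab_def Stab_all_def)
    \<comment> \<open>Both lines contribute multiples of \<open>w1 + w2\<close>, so dividing by it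
      leaves \<open>t1\<close> and \<open>t2\<close> with coefficient 1.\<close>
    then have "3 * wdeg w1 w2 f \<le> (real_of_rat t1 + real_of_rat t2 + real d) * (w1 + w2)"
      by (simp add: algebra_simps)
    then show ?thesis
      using pos by (simp add: pos_divide_le_eq[symmetric])
  qed
  have 2: "real_of_rat t2 - real_of_rat t1 * ((2 * w2 - w1) / (w1 + w2))
      - 3 * wdeg w1 w2 f / (w1 + w2) + real d \<ge> 0"
    if "peval l1 p = 0" and t: "(t1, t2) \<in> Stab d F l1 l2" for t1 t2
  proof -
    have "3 * wdeg w1 w2 f \<le> real d * (w1 + w2)
        - real_of_rat t1 * ((- 1 :: int) * w1 + (2 :: int) * w2) + real_of_rat t2 * (w1 + w2)"
      using t mu_line_through_ge[OF assms(2) A(1) that(1) normalized_weight_1ps]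
      by (intro bound) (auto simp: Stab_def Stab_all_def)
    \<comment> \<open>The first line now contributes \<open>2 * w2 - w1\<close>, whence the fraction
      multiplying \<open>t1\<close>.\<close>
    then have "3 * wdeg w1 w2 f / (w1 + w2) \<le> (real d * (w1 + w2)
        - real_of_rat t1 * (2 * w2 - w1) + real_of_rat t2 * (w1 + w2)) / (w1 + w2)"
      using pos by (intro divide_right_mono) (simp_all add: algebra_simps)
    also have "\<dots> = real d - real_of_rat t1 * ((2 * w2 - w1) / (w1 + w2)) + real_of_rat t2"
      using pos by (simp add: field_simps)
    finally show ?thesis
      by simp
  qed
  have "Stab d F l1 l2 \<subseteq> Stab_all d"
    by (auto simp: Stab_def)
  with 1 2 show ?thesis
    by blast
qed

end
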